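(* Let $R$ be a finite commutative ring with identity such that $\Gamma(R)$ is a complete graph, and let $F$ be a finite field with $|F|\geq 3$. Then $$\gamma^o(\Gamma(F \times R)) = |Z(R)^*| + \min \left\{ |U(R)|,\ |F^*|,\ 2 + \left\lfloor \frac{|U(R)|-|Z(R)^*|}{2} \right\rfloor + \left\lfloor \frac{|F^*|}{2} \right\rfloor \right\}.$$
   Context: $Z(R)^*$ denotes the set of nonzero zero-divisors of $R$, $U(R)$ the set of units of $R$, and $F^*=F\setminus\{0\}$. The zero-divisor graph $\Gamma(R)$ is the simple graph with vertex set $Z(R)^*$, in which distinct $u,v$ are adjacent if and only if $uv=0$. For a simple graph $\Gamma=(V,E)$, a set $S\subseteq V$ and a vertex $v$, let $\delta_S(v)$ be the number of neighbors of $v$ in $S$ and $\overline{S}=V\setminus S$. A nonempty set $S\subseteq V$ is a global offensive alliance if $\delta_S(v)\geq \delta_{\overline{S}}(v)+1$ for every $v\in\overline{S}$. $\gamma^o(\Gamma)$ is the minimum cardinality of a global offensive alliance of $\Gamma$. *)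

theory Defs
  imports Complex_Main "HOL-Algebra.Ring" "HOL-Algebra.Chinese_Remainder"
begin

(* A simple graph is a pair (V, E), where E consists of two-element subsets of V. *)

type_synonym 'a sgraph = "'a set \<times> 'a set set"

definition complete_sgraph :: "'a sgraph \<Rightarrow> bool" where
  "complete_sgraph G \<longleftrightarrow> (\<forall>u\<in>fst G. \<forall>v\<in>fst G. u \<noteq> v \<longrightarrow> {u, v} \<in> snd G)"

definition nbrs_in :: "'a sgraph \<Rightarrow> 'a set \<Rightarrow> 'a \<Rightarrow> nat" where
  "nbrs_in G S v = card {u \<in> S. {u, v} \<in> snd G}"

definition global_offensive_alliance :: "'a sgraph \<Rightarrow> 'a set \<Rightarrow> bool" where
  "global_offensive_alliance G S \<longleftrightarrow>
     S \<noteq> {} \<and> S \<subseteq> fst G \<and>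
     (\<forall>v \<in> fst G - S. nbrs_in G S v \<ge> nbrs_in G (fst G - S) v + 1)"

(* Intended for finite nonempty graphs, where the whole vertex set is a global offensive
   alliance, so that the minimum exists. *)

definition global_offensive_alliance_number :: "'a sgraph \<Rightarrow> nat" where
  "global_offensive_alliance_number G =
     (LEAST k. \<exists>S. global_offensive_alliance G S \<and> card S = k)"

definition nonzero_zero_divisors :: "('a, 'm) ring_scheme \<Rightarrow> 'a set" where
  "nonzero_zero_divisors R =
     {x \<in> carrier R. x \<noteq> \<zero>\<^bsub>R\<^esub> \<and> (\<exists>y \<in> carrier R. y \<noteq> \<zero>\<^bsub>R\<^esub> \<and> x \<otimes>\<^bsub>R\<^esub> y = \<zero>\<^bsub>R\<^esub>)}"

definition zero_divisor_graph :: "('a, 'm) ring_scheme \<Rightarrow> 'a sgraph" where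
  "zero_divisor_graph R =
     (nonzero_zero_divisors R,
      {{u, v} | u v. u \<in> nonzero_zero_divisors R \<and> v \<in> nonzero_zero_divisors R \<and>
                     u \<noteq> v \<and> u \<otimes>\<^bsub>R\<^esub> v = \<zero>\<^bsub>R\<^esub>})"

end

theory Submission
  imports Defs "HOL-Algebra.Multiplicative_Group"
begin

text \<open>
  In a ring with complete zero-divisor graph either all products of zero-divisors vanish, or some
  zero-divisor is a nontrivial idempotent and the ring is the product of two copies of the field
  with two elements. In the first case the vertices \<open>(a, r)\<close> of the graph of the product fall
  into four parts, with \<open>A\<close>: \<open>r = 0\<close>; \<open>B\<close>: \<open>a = 0\<close>, \<open>r\<close> a unit; \<open>C\<close>: \<open>a = 0\<close>, \<open>r\<close> a
  zero-divisor; \<open>D\<close>: \<open>a \<noteq> 0\<close>, \<open>r\<close> a zero-divisor. Here \<open>A\<close> is completely joined to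
  \<open>B\<close> and \<open>C\<close>, \<open>C\<close> is a clique completely joined to \<open>D\<close>, and there are no other edges. Hence being an
  alliance depends only on the four numbers of chosen vertices, and an optimal choice contains all
  of \<open>C\<close>, none of \<open>D\<close>, and either all of \<open>B\<close>, all of \<open>A\<close>, or just over half of \<open>A\<close>
  and as many vertices of \<open>B\<close> as the vertices in \<open>A\<close> then need. In the second case
  the number is 3, because three closed neighbourhoods are pairwise disjoint.
\<close>

section \<open>Alliances in arbitrary graphs\<close>

lemma global_offensive_alliance_numberI:
  assumes "global_offensive_alliance G S" "card S = k"
    and "\<And>T. global_offensive_alliance G T \<Longrightarrow> k \<le> card T"
  shows "global_offensive_alliance_number G = k"
  unfolding global_offensive_alliance_number_def
  using assms by (intro Least_equality) auto

text \<open>The \<open>+ 1\<close> in the alliance condition forces a vertex outside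
  \<open>S\<close> to have at least one neighbour in \<open>S\<close>. This turns pairwise disjoint
  closed neighbourhoods into lower bounds on \<open>card S\<close>.\<close>

lemma global_offensive_alliance_dominates:
  assumes "global_offensive_alliance G S" "v \<in> fst G"
  shows "\<exists>u\<in>S. u = v \<or> {u, v} \<in> snd G"
proof (cases "v \<in> S")
  case False
  then have "card {u \<in> S. {u, v} \<in> snd G} \<ge> 1"
    using assms unfolding global_offensive_alliance_def nbrs_in_def
    by (meson DiffI add_leE)
  then have "{u \<in> S. {u, v} \<in> snd G} \<noteq> {}"
    by (metis card.empty not_one_le_zero)
  then show ?thesis by auto
qed auto

section \<open>Alliances in a graph made of four uniform parts\<close>

text \<open>Each adjacency assumption fixes the part of \<open>v\<close> and lists its whole
  neighbourhood, which is the form needed to count neighbours. In \<open>adj_C\<close> the vertex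
  \<open>v\<close> is removed because the clique has no loops. Any part may be empty.\<close>

locale four_part_graph =
  fixes G :: "'a sgraph" and A B C D :: "'a set"
  assumes verts: "fst G = A \<union> B \<union> C \<union> D"
    and finite_parts: "finite A" "finite B" "finite C" "finite D"
    and disjoint_parts: "A \<inter> B = {}" "A \<inter> C = {}" "A \<inter> D = {}" "B \<inter> C = {}" "B \<inter> D = {}" "C \<inter> D = {}"
    and adj_A: "\<And>u v. u \<in> fst G \<Longrightarrow> v \<in> A \<Longrightarrow> {u, v} \<in> snd G \<longleftrightarrow> u \<in> B \<union> C"
    and adj_B: "\<And>u v. u \<in> fst G \<Longrightarrow> v \<in> B \<Longrightarrow> {u, v} \<in> snd G \<longleftrightarrow> u \<in> A"
    and adj_C: "\<And>u v. u \<in> fst G \<Longrightarrow> v \<in> C \<Longrightarrow> {u, v} \<in> snd G \<longleftrightarrow> u \<in> A \<union> (C - {v}) \<union> D"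
    and adj_D: "\<And>u v. u \<in> fst G \<Longrightarrow> v \<in> D \<Longrightarrow> {u, v} \<in> snd G \<longleftrightarrow> u \<in> C"
begin

lemma nbrs_A: "T \<subseteq> fst G \<Longrightarrow> v \<in> A \<Longrightarrow> nbrs_in G T v = card (T \<inter> B) + card (T \<inter> C)"
proof -
  assume *: "T \<subseteq> fst G" "v \<in> A"
  have "{u \<in> T. {u, v} \<in> snd G} = (T \<inter> B) \<union> (T \<inter> C)"
    using * adj_A[OF _ *(2)] by blast
  moreover have "card ((T \<inter> B) \<union> (T \<inter> C)) = card (T \<inter> B) + card (T \<inter> C)"
    using finite_parts disjoint_parts by (intro card_Un_disjoint) auto
  ultimately show ?thesis by (simp add: nbrs_in_def)
qed

lemma nbrs_B: "T \<subseteq> fst G \<Longrightarrow> v \<in> B \<Longrightarrow> nbrs_in G T v = card (T \<inter> A)"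
  unfolding nbrs_in_def using adj_B by (intro arg_cong[where f = card]) blast

lemma nbrs_D: "T \<subseteq> fst G \<Longrightarrow> v \<in> D \<Longrightarrow> nbrs_in G T v = card (T \<inter> C)"
  unfolding nbrs_in_def using adj_D by (intro arg_cong[where f = card]) blast

lemma nbrs_C:
  assumes "T \<subseteq> fst G" "v \<in> C"
  shows "nbrs_in G T v = card (T \<inter> A) + card (T \<inter> C - {v}) + card (T \<inter> D)"
proof -
  have "{u \<in> T. {u, v} \<in> snd G} = (T \<inter> A) \<union> (T \<inter> C - {v}) \<union> (T \<inter> D)"
    using assms adj_C[OF _ assms(2)] by blast
  moreover have "card ((T \<inter> A) \<union> (T \<inter> C - {v})) = card (T \<inter> A) + card (T \<inter> C - {v})"
    using finite_parts disjoint_parts by (intro card_Un_disjoint) auto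
  moreover have "card ((T \<inter> A) \<union> (T \<inter> C - {v}) \<union> (T \<inter> D)) = card ((T \<inter> A) \<union> (T \<inter> C - {v})) + card (T \<inter> D)"
    using finite_parts disjoint_parts by (intro card_Un_disjoint) auto
  ultimately show ?thesis by (simp add: nbrs_in_def)
qed

lemma card_parts:
  assumes "T \<subseteq> fst G"
  shows "card T = card (T \<inter> A) + card (T \<inter> B) + card (T \<inter> C) + card (T \<inter> D)"
proof -
  have "T = (T \<inter> A) \<union> ((T \<inter> B) \<union> ((T \<inter> C) \<union> (T \<inter> D)))"
    using assms verts by blast
  then have "card T = card ((T \<inter> A) \<union> ((T \<inter> B) \<union> ((T \<inter> C) \<union> (T \<inter> D))))" by simp
  also have "\<dots> = card (T \<inter> A) + (card (T \<inter> B) + (card (T \<inter> C) + card (T \<inter> D)))"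
    using finite_parts disjoint_parts
    by (subst card_Un_disjoint, simp, simp, blast)+ simp
  finally show ?thesis by simp
qed

lemma card_compl:
  assumes "P \<subseteq> fst G" "finite P"
  shows "card ((fst G - S) \<inter> P) + card (S \<inter> P) = card P"
proof -
  have "P = ((fst G - S) \<inter> P) \<union> (S \<inter> P)" using assms(1) by blast
  moreover have "card (((fst G - S) \<inter> P) \<union> (S \<inter> P)) = card ((fst G - S) \<inter> P) + card (S \<inter> P)"
    using assms(2) by (intro card_Un_disjoint) auto
  ultimately show ?thesis by simp
qed

text \<open>Expresses numerically that a part imposes no condition because none of its vertices lies
  outside \<open>S\<close>.\<close>

lemma card_Int_eq_iff:
  assumes "finite P"
  shows "P \<subseteq> S \<longleftrightarrow> card (S \<inter> P) = card P"
  using assms by (metis Int_absorb1 Int_lower1 Int_lower2 card_subset_eq inf.absorb_iff2)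

text \<open>All vertices outside \<open>S\<close> in one part have the same numbers of neighbours
  inside and outside \<open>S\<close>, so each part contributes one inequality, void when the part
  is contained in \<open>S\<close>.\<close>

lemma global_offensive_alliance_iff:
  assumes S: "S \<subseteq> fst G"
  shows "global_offensive_alliance G S \<longleftrightarrow>
    S \<noteq> {} \<and>
    (card (S \<inter> A) = card A \<or> card B + card C + 1 \<le> 2 * (card (S \<inter> B) + card (S \<inter> C))) \<and>
    (card (S \<inter> B) = card B \<or> card A + 1 \<le> 2 * card (S \<inter> A)) \<and>
    (card (S \<inter> C) = card C \<or>
       card A + card C + card D \<le> 2 * (card (S \<inter> A) + card (S \<inter> C) + card (S \<inter> D))) \<and>
    (card (S \<inter> D) = card D \<or> card C + 1 \<le> 2 * card (S \<inter> C))"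
proof -
  note S' = Diff_subset[of "fst G" S]
  have cA: "card ((fst G - S) \<inter> A) + card (S \<inter> A) = card A"
    and cB: "card ((fst G - S) \<inter> B) + card (S \<inter> B) = card B"
    and cC: "card ((fst G - S) \<inter> C) + card (S \<inter> C) = card C"
    and cD: "card ((fst G - S) \<inter> D) + card (S \<inter> D) = card D"
    by (rule card_compl; use finite_parts verts in blast)+
  let ?P = "\<lambda>v. nbrs_in G S v \<ge> nbrs_in G (fst G - S) v + 1"
  have A: "?P v \<longleftrightarrow> card B + card C + 1 \<le> 2 * (card (S \<inter> B) + card (S \<inter> C))" if "v \<in> A" for v
    using nbrs_A[OF S that] nbrs_A[OF S' that] cB cC by auto
  have B: "?P v \<longleftrightarrow> card A + 1 \<le> 2 * card (S \<inter> A)" if "v \<in> B" for v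
    using nbrs_B[OF S that] nbrs_B[OF S' that] cA by auto
  have D: "?P v \<longleftrightarrow> card C + 1 \<le> 2 * card (S \<inter> C)" if "v \<in> D" for v
    using nbrs_D[OF S that] nbrs_D[OF S' that] cC by auto
  have C: "?P v \<longleftrightarrow> card A + card C + card D \<le> 2 * (card (S \<inter> A) + card (S \<inter> C) + card (S \<inter> D))"
    if "v \<in> C - S" for v
  proof -
    have v: "v \<in> C" "v \<in> (fst G - S) \<inter> C" using that verts by auto
    \<comment> \<open>The vertex \<open>v\<close> is counted in its own part outside
      \<open>S\<close> but is not its own neighbour. This cancels the \<open>+ 1\<close>, so the
      inequality for \<open>C\<close> has none, unlike the other three.\<close>
    have C1: "card ((fst G - S) \<inter> C - {v}) + 1 = card ((fst G - S) \<inter> C)"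
      using v finite_parts card_Suc_Diff1[of "(fst G - S) \<inter> C" v] by simp
    have SC: "S \<inter> C - {v} = S \<inter> C" using that by auto
    show ?thesis
      unfolding nbrs_C[OF S v(1)] nbrs_C[OF S' v(1)] SC using C1 cA cC cD by presburger
  qed
  have "(\<forall>v\<in>fst G - S. ?P v) \<longleftrightarrow>
    (\<forall>v\<in>A-S. ?P v) \<and> (\<forall>v\<in>B-S. ?P v) \<and> (\<forall>v\<in>C-S. ?P v) \<and> (\<forall>v\<in>D-S. ?P v)"
    unfolding verts by blast
  also have "(\<forall>v\<in>A-S. ?P v) \<longleftrightarrow>
     card (S \<inter> A) = card A \<or> card B + card C + 1 \<le> 2 * (card (S \<inter> B) + card (S \<inter> C))"
    using A card_Int_eq_iff[OF finite_parts(1), of S] by blast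
  also have "(\<forall>v\<in>B-S. ?P v) \<longleftrightarrow> card (S \<inter> B) = card B \<or> card A + 1 \<le> 2 * card (S \<inter> A)"
    using B card_Int_eq_iff[OF finite_parts(2), of S] by blast
  also have "(\<forall>v\<in>C-S. ?P v) \<longleftrightarrow> card (S \<inter> C) = card C \<or>
      card A + card C + card D \<le> 2 * (card (S \<inter> A) + card (S \<inter> C) + card (S \<inter> D))"
    using C card_Int_eq_iff[OF finite_parts(3), of S] by blast
  also have "(\<forall>v\<in>D-S. ?P v) \<longleftrightarrow> card (S \<inter> D) = card D \<or> card C + 1 \<le> 2 * card (S \<inter> C)"
    using D card_Int_eq_iff[OF finite_parts(4), of S] by blast
  finally show ?thesis using S unfolding global_offensive_alliance_def by auto
qed

text \<open>Either \<open>B\<close> is full, or \<open>A\<close> is full, or \<open>S\<close> meets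
  both majority conditions; these cases give the three entries of the minimum. When \<open>C\<close>
  is not full, the size of \<open>D\<close> makes up for the missing vertices.\<close>

lemma global_offensive_alliance_card_ge:
  assumes "global_offensive_alliance G S"
    and D: "card D = card A * card C" and A: "2 \<le> card A" and CB: "card C \<le> card B"
  shows "card C + min (card B) (min (card A) (2 + (card B - card C) div 2 + card A div 2)) \<le> card S"
proof -
  have S: "S \<subseteq> fst G" using assms(1) by (simp add: global_offensive_alliance_def)
  define x y w t where xywt: "x = card (S \<inter> A)" "y = card (S \<inter> B)" "w = card (S \<inter> C)" "t = card (S \<inter> D)"
  have hS: "card S = x + y + w + t" using card_parts[OF S] xywt by simp
  have h: "x = card A \<or> card B + card C + 1 \<le> 2 * (y + w)"
    "y = card B \<or> card A + 1 \<le> 2 * x"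
    "w = card C \<or> card A + card C + card D \<le> 2 * (x + w + t)"
    "t = card D \<or> card C + 1 \<le> 2 * w"
    using assms(1) unfolding global_offensive_alliance_iff[OF S] xywt by blast+
  have le: "w \<le> card C"
    unfolding xywt using finite_parts by (auto intro!: card_mono)
  have D2: "2 * card C \<le> card D" using D A by simp
  consider "y = card B" | "x = card A" | "card B + card C + 1 \<le> 2 * (y + w)" "card A + 1 \<le> 2 * x"
    using h by blast
  then show ?thesis
  proof cases
    case 1
    \<comment> \<open>If \<open>C\<close> is not full, its inequality and \<open>D2\<close> bound
      \<open>2 * (x + w + t)\<close> below by \<open>3 * card C\<close>.\<close>
    have "card C \<le> x + w + t" using h(3) D2 by (elim disjE) auto
    then show ?thesis using hS 1 by simp
  next
    case 2
    \<comment> \<open>The chosen vertices of \<open>A\<close> are already accounted for, so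
      \<open>w + t\<close> alone must reach \<open>card C\<close>. A full \<open>D\<close> suffices
      by \<open>D2\<close>; the hard case is that neither \<open>C\<close> nor \<open>D\<close> is
      full.\<close>
    have "card C \<le> w + t"
    proof (cases "w = card C \<or> t = card D")
      case False
      then have c: "3 \<le> card C" using le h(4) by (elim disjE) auto
      \<comment> \<open>Writing \<open>card C\<close> as \<open>k + 1\<close> splits the product
        \<open>card A * card C\<close> into \<open>m + card A\<close> with
        \<open>2 * k \<le> m\<close>, after which only linear arithmetic remains.\<close>
      then obtain k where k: "card C = k + 1" by (metis Suc_eq_plus1 not0_implies_Suc not_numeral_le_zero)
      define m where "m = card A * k"
      have "card D = m + card A" using D k by (simp add: m_def)
      moreover have "2 * k \<le> m" using A by (simp add: m_def)
      moreover have "card A + card C + card D \<le> 2 * (x + w + t)" using h(3) False by blast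
      ultimately show ?thesis using 2 c k by simp
    qed (use D2 in auto)
    then show ?thesis using hS 2 by simp
  next
    case 3
    \<comment> \<open>Each of the two strict majorities rounds up to a half plus one, which is where
      the constant 2 comes from; \<open>d\<close> replaces the truncated subtraction.\<close>
    obtain d where d: "card B = card C + d" using CB le_Suc_ex by blast
    have "card C + (2 + d div 2 + card A div 2) \<le> x + y + w" using 3 d by presburger
    then show ?thesis using hS d by (simp add: min_le_iff_disj)
  qed
qed

text \<open>Once \<open>C\<close> is contained in \<open>S\<close> and nonempty, vertices of
  \<open>D\<close> have all their neighbours in \<open>S\<close>. Only the conditions for
  \<open>A\<close> and \<open>B\<close> are left, unless \<open>C\<close> is empty, when
  \<open>D\<close> must be empty too.\<close>

lemma global_offensive_allianceI_full_C:
  assumes S: "C \<subseteq> S" "S \<subseteq> fst G" "S \<noteq> {}"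
    and C: "C \<noteq> {} \<or> D = {}"
    and "A \<subseteq> S \<or> card B + 1 \<le> 2 * card (S \<inter> B) + card C"
    and "B \<subseteq> S \<or> card A + 1 \<le> 2 * card (S \<inter> A)"
  shows "global_offensive_alliance G S"
proof -
  have "card (S \<inter> C) = card C" using S(1) by (simp add: Int_absorb1)
  moreover have "card D = 0 \<and> card (S \<inter> D) = 0 \<or> card C > 0"
    using C finite_parts by (auto simp: card_gt_0_iff)
  ultimately show ?thesis
    unfolding global_offensive_alliance_iff[OF S(2)] using assms(3,5,6)
    by (auto simp: card_Int_eq_iff[OF finite_parts(1)] card_Int_eq_iff[OF finite_parts(2)])
qed

text \<open>The witnesses are \<open>B \<union> C\<close>, \<open>A \<union> C\<close> and
  \<open>X \<union> Y \<union> C\<close>, with \<open>X\<close> and \<open>Y\<close> just large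
  enough subsets of \<open>A\<close> and \<open>B\<close>.\<close>

lemma global_offensive_alliance_exists:
  assumes D: "card D = card A * card C" and A: "2 \<le> card A" and B: "0 < card B"
    and CB: "card C \<le> card B"
  shows "\<exists>S. global_offensive_alliance G S \<and>
    card S = card C + min (card B) (min (card A) (2 + (card B - card C) div 2 + card A div 2))"
proof -
  have CD: "C \<noteq> {} \<or> D = {}" using D finite_parts by auto
  have ne: "A \<noteq> {}" "B \<noteq> {}" using A B by auto
  \<comment> \<open>\<open>?x\<close> is the least size with \<open>card A + 1 \<le> 2 * ?x\<close>,
    and \<open>?y\<close> the least with \<open>card B + 1 \<le> 2 * ?y + card C\<close>; their two
    units add up to the 2 of the formula.\<close>
  let ?y = "(card B - card C) div 2 + 1" and ?x = "card A div 2 + 1"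
  \<comment> \<open>When the sum attains the minimum it is at most \<open>card A\<close> and
    \<open>card B\<close>, so subsets of these sizes exist.\<close>
  consider "min (card B) (min (card A) (?y + ?x)) = card B"
    | "min (card B) (min (card A) (?y + ?x)) = card A"
    | "min (card B) (min (card A) (?y + ?x)) = ?y + ?x" "?y + ?x \<le> card A" "?y + ?x \<le> card B"
    by linarith
  then have "\<exists>S. global_offensive_alliance G S \<and> card S = card C + min (card B) (min (card A) (?y + ?x))"
  proof cases
    case 1
    have "global_offensive_alliance G (B \<union> C)"
      using ne CD B verts by (intro global_offensive_allianceI_full_C) (auto simp: Int_absorb1)
    moreover have "card (B \<union> C) = card C + card B"
      using finite_parts disjoint_parts by (simp add: card_Un_disjoint)
    ultimately show ?thesis unfolding 1 by blast
  next
    case 2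
    have "global_offensive_alliance G (A \<union> C)"
      using ne CD A verts by (intro global_offensive_allianceI_full_C) (auto simp: Int_absorb1)
    moreover have "card (A \<union> C) = card C + card A"
      using finite_parts disjoint_parts by (simp add: card_Un_disjoint)
    ultimately show ?thesis unfolding 2 by blast
  next
    case 3
    obtain X where X: "X \<subseteq> A" "card X = ?x"
      using obtain_subset_with_card_n[of ?x A] 3 by auto
    obtain Y where Y: "Y \<subseteq> B" "card Y = ?y"
      using obtain_subset_with_card_n[of ?y B] 3 by auto
    have fin: "finite X" "finite Y" using X(1) Y(1) finite_parts finite_subset by auto
    have int: "(X \<union> Y \<union> C) \<inter> A = X" "(X \<union> Y \<union> C) \<inter> B = Y"
      using X(1) Y(1) disjoint_parts by blast+
    have "global_offensive_alliance G (X \<union> Y \<union> C)"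
    proof (rule global_offensive_allianceI_full_C)
      show "X \<union> Y \<union> C \<noteq> {}" using X(2) by auto
    qed (use CD X Y verts in \<open>auto simp: int\<close>)
    moreover have "X \<inter> Y = {}" "(X \<union> Y) \<inter> C = {}"
      using X(1) Y(1) disjoint_parts by blast+
    then have "card (X \<union> Y \<union> C) = card C + (?y + ?x)"
      using finite_parts fin X(2) Y(2) by (simp add: card_Un_disjoint)
    ultimately show ?thesis unfolding 3(1) by blast
  qed
  then show ?thesis by (simp add: add_ac numeral_2_eq_2)
qed

lemma global_offensive_alliance_number_eq:
  assumes "card D = card A * card C" "2 \<le> card A" "0 < card B" "card C \<le> card B"
  shows "global_offensive_alliance_number G =
    card C + min (card B) (min (card A) (2 + (card B - card C) div 2 + card A div 2))"
  using global_offensive_alliance_exists[OF assms]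
    global_offensive_alliance_card_ge[OF _ assms(1,2,4)]
  by (blast intro: global_offensive_alliance_numberI)

end

section \<open>Zero-divisors and units in a commutative ring\<close>

text \<open>An edge is an unordered pair, so commutativity is what allows its product to be read in
  either order.\<close>

lemma (in cring) edge_zero_divisor_graph_iff:
  "{u, v} \<in> snd (zero_divisor_graph R) \<longleftrightarrow>
     u \<in> nonzero_zero_divisors R \<and> v \<in> nonzero_zero_divisors R \<and> u \<noteq> v \<and> u \<otimes> v = \<zero>"
proof -
  have "u \<otimes> v = v \<otimes> u" if "u \<in> nonzero_zero_divisors R" "v \<in> nonzero_zero_divisors R"
    using that by (intro m_comm) (simp_all add: nonzero_zero_divisors_def)
  then show ?thesis unfolding zero_divisor_graph_def by (auto simp: doubleton_eq_iff)
qed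

lemma fst_zero_divisor_graph: "fst (zero_divisor_graph R) = nonzero_zero_divisors R"
  by (simp add: zero_divisor_graph_def)

lemma (in cring) Units_mult_eq_zeroD:
  assumes "x \<in> Units R" "y \<in> carrier R" "x \<otimes> y = \<zero>"
  shows "y = \<zero>"
proof -
  have "y = (inv x \<otimes> x) \<otimes> y" using assms by simp
  also have "\<dots> = inv x \<otimes> (x \<otimes> y)" using assms by (intro m_assoc) auto
  also have "\<dots> = \<zero>" using assms by simp
  finally show ?thesis .
qed

lemma (in cring) Units_Int_zero_divisors: "Units R \<inter> nonzero_zero_divisors R = {}"
  using Units_mult_eq_zeroD by (auto simp: nonzero_zero_divisors_def)

text \<open>Multiplication by an element that is not a zero-divisor is injective, hence surjective
  on a finite carrier, and so it attains \<open>\<one>\<close>.\<close>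

lemma (in cring) finite_nonzero_cases:
  assumes "finite (carrier R)" "x \<in> carrier R" "x \<noteq> \<zero>"
  shows "x \<in> nonzero_zero_divisors R \<or> x \<in> Units R"
proof (cases "x \<in> nonzero_zero_divisors R")
  case False
  then have reg: "y = \<zero>" if "y \<in> carrier R" "x \<otimes> y = \<zero>" for y
    using assms that by (auto simp: nonzero_zero_divisors_def)
  have "inj_on (\<lambda>y. x \<otimes> y) (carrier R)"
  proof (rule inj_onI)
    fix y z assume yz: "y \<in> carrier R" "z \<in> carrier R" "x \<otimes> y = x \<otimes> z"
    then have "x \<otimes> (y \<ominus> z) = \<zero>"
      using assms(2) by (simp add: minus_eq r_distr r_minus r_neg)
    then have "y \<ominus> z = \<zero>" using reg yz by simp
    then show "y = z" using yz by simp
  qed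
  then have "(\<lambda>y. x \<otimes> y) ` carrier R = carrier R"
    using assms by (intro endo_inj_surj) auto
  then obtain y where "y \<in> carrier R" "x \<otimes> y = \<one>" by (metis imageE one_closed)
  then have "x \<in> Units R" using assms(2) m_comm[of y x] unfolding Units_def by auto
  then show ?thesis ..
qed simp

lemma (in cring) nonzero_zero_divisors_mult:
  assumes "x \<in> nonzero_zero_divisors R" "r \<in> carrier R" "r \<otimes> x \<noteq> \<zero>"
  shows "r \<otimes> x \<in> nonzero_zero_divisors R"
proof -
  obtain y where x: "x \<in> carrier R" and y: "y \<in> carrier R" "y \<noteq> \<zero>" "x \<otimes> y = \<zero>"
    using assms(1) unfolding nonzero_zero_divisors_def by blast
  then have "(r \<otimes> x) \<otimes> y = \<zero>" using assms(2) by (simp add: m_assoc)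
  then show ?thesis using assms(2,3) x y(1,2) unfolding nonzero_zero_divisors_def by blast
qed

text \<open>If \<open>x\<close> squares to zero, then 1 + x is a unit with inverse 1 - x, and x is
  recovered from 1 + x. This supplies the inequality between the sizes of \<open>C\<close> and
  \<open>B\<close>.\<close>

lemma (in cring) card_zero_divisors_le_card_Units:
  assumes "finite (carrier R)"
    and sq: "\<And>x. x \<in> nonzero_zero_divisors R \<Longrightarrow> x \<otimes> x = \<zero>"
  shows "card (nonzero_zero_divisors R) \<le> card (Units R)"
proof (rule card_inj_on_le[where f = "\<lambda>x. \<one> \<oplus> x"])
  show "inj_on (\<lambda>x. \<one> \<oplus> x) (nonzero_zero_divisors R)"
    by (rule inj_onI) (auto simp: nonzero_zero_divisors_def)
  have "\<one> \<oplus> x \<in> Units R" if "x \<in> nonzero_zero_divisors R" for x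
  proof -
    have x: "x \<in> carrier R" using that by (simp add: nonzero_zero_divisors_def)
    have "(\<one> \<oplus> x) \<otimes> (\<one> \<ominus> x) = \<one> \<ominus> x \<otimes> x" using x by algebra
    then have "(\<one> \<oplus> x) \<otimes> (\<one> \<ominus> x) = \<one>" using sq[OF that] by (simp add: minus_eq)
    moreover from this have "(\<one> \<ominus> x) \<otimes> (\<one> \<oplus> x) = \<one>" using x m_comm by simp
    ultimately show ?thesis using x unfolding Units_def by auto
  qed
  then show "(\<lambda>x. \<one> \<oplus> x) ` nonzero_zero_divisors R \<subseteq> Units R" by auto
  show "finite (Units R)" using assms(1) Units_closed finite_subset by blast
qed

section \<open>Rings whose zero-divisor graph is complete\<close>

text \<open>Otherwise \<open>e\<close> and its square are distinct zero-divisors, so the cube of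
  \<open>e\<close> vanishes. Then the sum of \<open>e\<close> and its square is a zero-divisor other
  than \<open>e\<close>, yet its product with \<open>e\<close> is the nonzero square of
  \<open>e\<close>.\<close>

lemma (in cring) complete_zero_divisor_graph_idempotent:
  assumes compl: "\<And>u v. u \<in> nonzero_zero_divisors R \<Longrightarrow> v \<in> nonzero_zero_divisors R \<Longrightarrow> u \<noteq> v \<Longrightarrow> u \<otimes> v = \<zero>"
    and e: "e \<in> nonzero_zero_divisors R" "e \<otimes> e \<noteq> \<zero>"
  shows "e \<otimes> e = e"
proof (rule ccontr)
  assume ne: "e \<otimes> e \<noteq> e"
  have c: "e \<in> carrier R" using e by (simp add: nonzero_zero_divisors_def)
  have cube: "e \<otimes> (e \<otimes> e) = \<zero>"
    using compl[OF e(1) nonzero_zero_divisors_mult[OF e(1) c e(2)]] ne by metis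
  \<comment> \<open>Exhibits the sum as a multiple of \<open>e\<close>, so that it is a zero-divisor
    as soon as it is nonzero.\<close>
  have eq: "(\<one> \<oplus> e) \<otimes> e = e \<oplus> e \<otimes> e" using c by algebra
  have ee: "e \<otimes> (e \<oplus> e \<otimes> e) = e \<otimes> e" using c cube by (simp add: r_distr)
  have "e \<oplus> e \<otimes> e \<noteq> \<zero>" using ee e(2) c by auto
  then have "e \<oplus> e \<otimes> e \<in> nonzero_zero_divisors R"
    using nonzero_zero_divisors_mult[OF e(1), of "\<one> \<oplus> e"] c eq by simp
  moreover have "e \<oplus> e \<otimes> e \<noteq> e" using c e(2) by simp
  ultimately show False using compl[OF e(1)] ee e(2) by metis
qed

text \<open>Peirce decomposition along the idempotents e and 1 - e: each of the two ideals they
  generate contains only zero and its generator, so the carrier consists of 0, e, 1 - e and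
  1.\<close>

lemma (in cring) complete_zero_divisor_graph_not_square_zero:
  assumes compl: "\<And>u v. u \<in> nonzero_zero_divisors R \<Longrightarrow> v \<in> nonzero_zero_divisors R \<Longrightarrow> u \<noteq> v \<Longrightarrow> u \<otimes> v = \<zero>"
    and e: "e \<in> nonzero_zero_divisors R" "e \<otimes> e \<noteq> \<zero>"
  obtains f where "f \<noteq> e" "e \<otimes> f = \<zero>" "f \<otimes> f = f"
    "nonzero_zero_divisors R = {e, f}" "Units R = {\<one>}"
proof -
  have c: "e \<in> carrier R" "e \<noteq> \<zero>" using e by (simp_all add: nonzero_zero_divisors_def)
  have id: "e \<otimes> e = e" using complete_zero_divisor_graph_idempotent[OF compl e] .
  define f where "f = \<one> \<ominus> e"
  have fc: "f \<in> carrier R" using c by (simp add: f_def)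
  have ef: "e \<otimes> f = \<zero>" using c id by (simp add: f_def minus_eq r_distr r_minus r_neg)
  have "e \<noteq> \<one>" using Units_Int_zero_divisors e by auto
  then have f0: "f \<noteq> \<zero>" using c by (auto simp: f_def)
  have ff: "f \<otimes> f = f" using c ef fc
    by (metis (no_types, opaque_lifting) f_def l_minus l_one l_distr l_zero minus_eq one_closed a_inv_closed minus_zero r_zero)
  have fZ: "f \<in> nonzero_zero_divisors R"
    using c fc ef f0 m_comm by (auto simp: nonzero_zero_divisors_def)
  have fe: "f \<noteq> e" using ef id c by auto
  \<comment> \<open>A multiple of \<open>g\<close> other than \<open>\<zero>\<close> and
    \<open>g\<close> would be a zero-divisor adjacent to \<open>g\<close>, but multiplying it by the
    idempotent \<open>g\<close> leaves it unchanged.\<close>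
  have mult: "x \<otimes> g = \<zero> \<or> x \<otimes> g = g"
    if "g \<in> nonzero_zero_divisors R" "g \<otimes> g = g" "x \<in> carrier R" for x g
  proof (rule ccontr)
    assume n: "\<not> (x \<otimes> g = \<zero> \<or> x \<otimes> g = g)"
    have gc: "g \<in> carrier R" using that by (simp add: nonzero_zero_divisors_def)
    have "(x \<otimes> g) \<otimes> g = \<zero>"
      using n compl[OF nonzero_zero_divisors_mult that(1)] that by blast
    then show False using n that gc by (simp add: m_assoc)
  qed
  have sum: "e \<oplus> f = \<one>" using c unfolding f_def by algebra
  have carr: "x \<in> {\<zero>, e, f, \<one>}" if "x \<in> carrier R" for x
  proof -
    have "x = x \<otimes> e \<oplus> x \<otimes> f" using sum that c fc by (metis r_distr r_one)
    moreover have "x \<otimes> e = \<zero> \<or> x \<otimes> e = e" "x \<otimes> f = \<zero> \<or> x \<otimes> f = f"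
      using mult e(1) id fZ ff that by auto
    ultimately show ?thesis using sum c fc by auto
  qed
  have "Units R = {\<one>}" "nonzero_zero_divisors R = {e, f}"
  proof -
    have "\<zero> \<notin> Units R" using Units_mult_eq_zeroD[of \<zero> e] c by auto
    moreover have "e \<notin> Units R" "f \<notin> Units R" using Units_Int_zero_divisors e(1) fZ by auto
    ultimately have "x = \<one>" if "x \<in> Units R" for x
      using carr[OF Units_closed[OF that]] that by auto
    then show "Units R = {\<one>}" using Units_one_closed by blast
    have "\<one> \<notin> nonzero_zero_divisors R" using Units_Int_zero_divisors by auto
    moreover have "x \<in> carrier R" "x \<noteq> \<zero>" if "x \<in> nonzero_zero_divisors R" for x
      using that by (auto simp: nonzero_zero_divisors_def)
    ultimately have "x = e \<or> x = f" if "x \<in> nonzero_zero_divisors R" for x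
      using carr that by blast
    then show "nonzero_zero_divisors R = {e, f}" using e(1) fZ by blast
  qed
  then show ?thesis using that fe ef ff by blast
qed

section \<open>The zero-divisor graph of a product with a field\<close>

lemma mult_RDirProd: "x \<otimes>\<^bsub>RDirProd R S\<^esub> y = (fst x \<otimes>\<^bsub>R\<^esub> fst y, snd x \<otimes>\<^bsub>S\<^esub> snd y)"
  by (simp add: RDirProd_def monoid.defs DirProd_def case_prod_beta)

lemma zero_RDirProd: "\<zero>\<^bsub>RDirProd R S\<^esub> = (\<zero>\<^bsub>R\<^esub>, \<zero>\<^bsub>S\<^esub>)"
  by (simp add: RDirProd_def monoid.defs)

lemma cring_RDirProd:
  assumes "cring R" "cring S"
  shows "cring (RDirProd R S)"
proof -
  interpret R: cring R by fact
  interpret S: cring S by fact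
  interpret P: ring "RDirProd R S" using RDirProd_ring R.ring_axioms S.ring_axioms .
  show ?thesis
    by unfold_locales (auto simp: mult_RDirProd RDirProd_carrier R.m_comm S.m_comm)
qed

text \<open>The first part is annihilated by (0, 1), the next two by (1, 0), and the last by (0, y)
  where y annihilates the second component. Conversely, a nonzero second component is a zero-divisor
  or a unit since \<open>R\<close> is finite.\<close>

lemma nonzero_zero_divisors_RDirProd:
  assumes "field F" "cring R" "\<one>\<^bsub>R\<^esub> \<noteq> \<zero>\<^bsub>R\<^esub>" "finite (carrier R)"
  shows "nonzero_zero_divisors (RDirProd F R) =
    (carrier F - {\<zero>\<^bsub>F\<^esub>}) \<times> {\<zero>\<^bsub>R\<^esub>} \<union> {\<zero>\<^bsub>F\<^esub>} \<times> Units R \<union>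
    {\<zero>\<^bsub>F\<^esub>} \<times> nonzero_zero_divisors R \<union> (carrier F - {\<zero>\<^bsub>F\<^esub>}) \<times> nonzero_zero_divisors R"
    (is "?L = ?A \<union> ?B \<union> ?C \<union> ?D")
proof -
  interpret F: field F by fact
  interpret R: cring R by fact
  have "x \<in> ?L" if "x \<in> ?A" for x
    using that assms(3) unfolding nonzero_zero_divisors_def
    by (auto simp: mult_RDirProd RDirProd_carrier zero_RDirProd
        intro!: bexI[of _ "\<zero>\<^bsub>F\<^esub>"] bexI[of _ "\<one>\<^bsub>R\<^esub>"])
  moreover have "x \<in> ?L" if "x \<in> ?B \<union> ?C" for x
  proof -
    have "\<zero>\<^bsub>R\<^esub> \<notin> Units R" using R.Units_mult_eq_zeroD[of "\<zero>\<^bsub>R\<^esub>" "\<one>\<^bsub>R\<^esub>"] assms(3) by auto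
    then show ?thesis
      using that unfolding nonzero_zero_divisors_def
      by (auto simp: mult_RDirProd RDirProd_carrier zero_RDirProd 
          intro!: bexI[of _ "\<one>\<^bsub>F\<^esub>"] bexI[of _ "\<zero>\<^bsub>R\<^esub>"])
  qed
  moreover have "x \<in> ?L" if D: "x \<in> ?D" for x
  proof -
    have "snd x \<in> nonzero_zero_divisors R" using D by auto
    then obtain y where "y \<in> carrier R" "y \<noteq> \<zero>\<^bsub>R\<^esub>" "snd x \<otimes>\<^bsub>R\<^esub> y = \<zero>\<^bsub>R\<^esub>"
      unfolding nonzero_zero_divisors_def by blast
    then show ?thesis using D unfolding nonzero_zero_divisors_def
      by (auto simp: mult_RDirProd RDirProd_carrier zero_RDirProd 
          intro!: bexI[of _ "\<zero>\<^bsub>F\<^esub>"] bexI[of _ y])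
  qed
  moreover have "x \<in> ?A \<union> ?B \<union> ?C \<union> ?D" if L: "x \<in> ?L" for x
  proof -
    obtain a r where x: "x = (a, r)" by (cases x)
    obtain b s where bs: "b \<in> carrier F" "s \<in> carrier R" "b \<noteq> \<zero>\<^bsub>F\<^esub> \<or> s \<noteq> \<zero>\<^bsub>R\<^esub>"
      "a \<otimes>\<^bsub>F\<^esub> b = \<zero>\<^bsub>F\<^esub>" "r \<otimes>\<^bsub>R\<^esub> s = \<zero>\<^bsub>R\<^esub>"
      and ar: "a \<in> carrier F" "r \<in> carrier R" "a \<noteq> \<zero>\<^bsub>F\<^esub> \<or> r \<noteq> \<zero>\<^bsub>R\<^esub>"
      using L unfolding nonzero_zero_divisors_def x
      by (auto simp: mult_RDirProd RDirProd_carrier zero_RDirProd)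
    \<comment> \<open>If \<open>a\<close> were nonzero and \<open>r\<close> a unit, both
      \<open>b\<close> and \<open>s\<close> would be zero.\<close>
    have "a = \<zero>\<^bsub>F\<^esub> \<or> r \<notin> Units R"
      using F.integral[OF bs(4) ar(1) bs(1)] R.Units_mult_eq_zeroD[OF _ bs(2,5)] bs(3) by auto
    then show ?thesis using R.finite_nonzero_cases[OF assms(4) ar(2)] ar x by auto
  qed
  ultimately show ?thesis by blast
qed

text \<open>A product of pairs vanishes componentwise: in the field one factor must be zero, a unit
  of \<open>R\<close> is annihilated only by zero, and two zero-divisors of \<open>R\<close> always
  annihilate each other by \<open>Z\<close>.\<close>

lemma four_part_graph_RDirProd:
  assumes "field F" "cring R" "\<one>\<^bsub>R\<^esub> \<noteq> \<zero>\<^bsub>R\<^esub>" "finite (carrier R)" "finite (carrier F)"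
    and Z: "\<And>x y. x \<in> nonzero_zero_divisors R \<Longrightarrow> y \<in> nonzero_zero_divisors R \<Longrightarrow> x \<otimes>\<^bsub>R\<^esub> y = \<zero>\<^bsub>R\<^esub>"
  shows "four_part_graph (zero_divisor_graph (RDirProd F R))
    ((carrier F - {\<zero>\<^bsub>F\<^esub>}) \<times> {\<zero>\<^bsub>R\<^esub>}) ({\<zero>\<^bsub>F\<^esub>} \<times> Units R)
    ({\<zero>\<^bsub>F\<^esub>} \<times> nonzero_zero_divisors R) ((carrier F - {\<zero>\<^bsub>F\<^esub>}) \<times> nonzero_zero_divisors R)"
proof -
  interpret F: field F by fact
  interpret R: cring R by fact
  interpret P: cring "RDirProd F R" using F.is_cring R.is_cring by (rule cring_RDirProd)
  note V = nonzero_zero_divisors_RDirProd[OF assms(1-4)]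
  have U0: "\<zero>\<^bsub>R\<^esub> \<notin> Units R" using R.Units_mult_eq_zeroD[of "\<zero>\<^bsub>R\<^esub>" "\<one>\<^bsub>R\<^esub>"] assms(3) by auto
  have Z0: "\<zero>\<^bsub>R\<^esub> \<notin> nonzero_zero_divisors R" by (simp add: nonzero_zero_divisors_def)
  have Zc: "x \<in> carrier R" if "x \<in> nonzero_zero_divisors R" for x
    using that by (simp add: nonzero_zero_divisors_def)
  have UZ: "x \<notin> nonzero_zero_divisors R" if "x \<in> Units R" for x
    using that R.Units_Int_zero_divisors by auto
  have ur: "x \<otimes>\<^bsub>R\<^esub> y = \<zero>\<^bsub>R\<^esub> \<longleftrightarrow> y = \<zero>\<^bsub>R\<^esub>" if "x \<in> Units R" "y \<in> carrier R" for x y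
    using that R.Units_mult_eq_zeroD by auto
  have ru: "y \<otimes>\<^bsub>R\<^esub> x = \<zero>\<^bsub>R\<^esub> \<longleftrightarrow> y = \<zero>\<^bsub>R\<^esub>" if "x \<in> Units R" "y \<in> carrier R" for x y
    using that ur R.m_comm by (metis R.Units_closed)
  have fin: "finite (nonzero_zero_divisors R)" "finite (Units R)"
    using assms(4) Zc R.Units_closed by (auto intro: finite_subset)
  note edge = P.edge_zero_divisor_graph_iff mult_RDirProd zero_RDirProd V
    F.integral_iff ur ru Z Zc
  show ?thesis
  proof
    show "fst (zero_divisor_graph (RDirProd F R)) = (carrier F - {\<zero>\<^bsub>F\<^esub>}) \<times> {\<zero>\<^bsub>R\<^esub>} \<union> {\<zero>\<^bsub>F\<^esub>} \<times> Units R \<union>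
    {\<zero>\<^bsub>F\<^esub>} \<times> nonzero_zero_divisors R \<union> (carrier F - {\<zero>\<^bsub>F\<^esub>}) \<times> nonzero_zero_divisors R"
      using V by (simp add: fst_zero_divisor_graph)
  qed (use fin assms(5) U0 Z0 UZ in \<open>auto simp: fst_zero_divisor_graph edge dest: R.Units_mult_eq_zeroD\<close>)
qed

section \<open>The exceptional ring with two nontrivial idempotents\<close>

text \<open>The three vertices with first component zero form an alliance: the remaining vertices
  are pairwise nonadjacent, and each has a neighbour among the three.\<close>

lemma global_offensive_alliance_number_RDirProd_idempotents:
  assumes "field F" "cring R" "\<one>\<^bsub>R\<^esub> \<noteq> \<zero>\<^bsub>R\<^esub>" "finite (carrier R)" "finite (carrier F)"
    and e: "e \<otimes>\<^bsub>R\<^esub> e = e" "f \<otimes>\<^bsub>R\<^esub> f = f" "e \<otimes>\<^bsub>R\<^esub> f = \<zero>\<^bsub>R\<^esub>" "e \<noteq> f"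
      "nonzero_zero_divisors R = {e, f}" "Units R = {\<one>\<^bsub>R\<^esub>}"
  shows "global_offensive_alliance_number (zero_divisor_graph (RDirProd F R)) = 3"
proof -
  interpret F: field F by fact
  interpret R: cring R by fact
  interpret P: cring "RDirProd F R" using F.is_cring R.is_cring by (rule cring_RDirProd)
  have ec: "e \<in> carrier R" "f \<in> carrier R" "e \<noteq> \<zero>\<^bsub>R\<^esub>" "f \<noteq> \<zero>\<^bsub>R\<^esub>"
    using e(5) by (auto simp: nonzero_zero_divisors_def)
  have fe: "f \<otimes>\<^bsub>R\<^esub> e = \<zero>\<^bsub>R\<^esub>" using e(3) ec R.m_comm by simp
  have ne1: "e \<noteq> \<one>\<^bsub>R\<^esub>" "f \<noteq> \<one>\<^bsub>R\<^esub>" using R.Units_Int_zero_divisors e(5) by auto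
  let ?G = "zero_divisor_graph (RDirProd F R)"
  let ?Fs = "carrier F - {\<zero>\<^bsub>F\<^esub>}"
  have V: "fst ?G = ?Fs \<times> {\<zero>\<^bsub>R\<^esub>} \<union> {\<zero>\<^bsub>F\<^esub>} \<times> {\<one>\<^bsub>R\<^esub>} \<union> {\<zero>\<^bsub>F\<^esub>} \<times> {e, f} \<union> ?Fs \<times> {e, f}"
    using nonzero_zero_divisors_RDirProd[OF assms(1-4)] e(5,6)
    by (simp add: fst_zero_divisor_graph)
  have edge: "{u, v} \<in> snd ?G \<longleftrightarrow> u \<in> fst ?G \<and> v \<in> fst ?G \<and> u \<noteq> v \<and>
      fst u \<otimes>\<^bsub>F\<^esub> fst v = \<zero>\<^bsub>F\<^esub> \<and> snd u \<otimes>\<^bsub>R\<^esub> snd v = \<zero>\<^bsub>R\<^esub>" for u v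
    by (simp add: P.edge_zero_divisor_graph_iff mult_RDirProd zero_RDirProd fst_zero_divisor_graph)
  have finV: "finite (fst ?G)" unfolding V using assms(5) by simp
  let ?S = "{(\<zero>\<^bsub>F\<^esub>, \<one>\<^bsub>R\<^esub>), (\<zero>\<^bsub>F\<^esub>, e), (\<zero>\<^bsub>F\<^esub>, f)}"
  show ?thesis
  proof (rule global_offensive_alliance_numberI)
    show "card ?S = 3" using ne1 e(4) by auto
    have "nbrs_in ?G (fst ?G - ?S) v + 1 \<le> nbrs_in ?G ?S v" if v: "v \<in> fst ?G - ?S" for v
    proof -
      have v': "fst v \<in> ?Fs" "snd v \<in> {\<zero>\<^bsub>R\<^esub>, e, f}" using v unfolding V by auto
      \<comment> \<open>Vertices outside \<open>?S\<close> have nonzero first components, whose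
        products are nonzero in a field.\<close>
      have "{u \<in> fst ?G - ?S. {u, v} \<in> snd ?G} = {}"
        using v' unfolding edge by (auto simp: V F.integral_iff)
      then have "nbrs_in ?G (fst ?G - ?S) v = 0" unfolding nbrs_in_def by (metis card.empty)
      moreover have "\<exists>u\<in>?S. snd u \<otimes>\<^bsub>R\<^esub> snd v = \<zero>\<^bsub>R\<^esub>"
        using v'(2) e(3) fe by auto
      then obtain u where u: "u \<in> ?S" "snd u \<otimes>\<^bsub>R\<^esub> snd v = \<zero>\<^bsub>R\<^esub>" by blast
      have "?S \<subseteq> fst ?G" "\<forall>u\<in>?S. fst u = \<zero>\<^bsub>F\<^esub>" unfolding V by auto
      then have "{u, v} \<in> snd ?G" using u v v'(1) unfolding edge by fastforce
      then have "{u \<in> ?S. {u, v} \<in> snd ?G} \<noteq> {}" using u(1) by blast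
      then have "nbrs_in ?G ?S v > 0" unfolding nbrs_in_def by (simp add: card_gt_0_iff)
      ultimately show ?thesis by simp
    qed
    then show "global_offensive_alliance ?G ?S"
      unfolding global_offensive_alliance_def V by auto
  next
    fix T assume T: "global_offensive_alliance ?G T"
    have TV: "T \<subseteq> fst ?G" using T by (simp add: global_offensive_alliance_def)
    \<comment> \<open>The closed neighbourhoods of these three vertices are pairwise disjoint.\<close>
    obtain p where p: "p \<in> T" "p = (\<zero>\<^bsub>F\<^esub>, \<one>\<^bsub>R\<^esub>) \<or> {p, (\<zero>\<^bsub>F\<^esub>, \<one>\<^bsub>R\<^esub>)} \<in> snd ?G"
      using global_offensive_alliance_dominates[OF T, of "(\<zero>\<^bsub>F\<^esub>, \<one>\<^bsub>R\<^esub>)"] unfolding V by auto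
    obtain q where q: "q \<in> T" "q = (\<one>\<^bsub>F\<^esub>, e) \<or> {q, (\<one>\<^bsub>F\<^esub>, e)} \<in> snd ?G"
      using global_offensive_alliance_dominates[OF T, of "(\<one>\<^bsub>F\<^esub>, e)"] unfolding V by auto
    obtain r where r: "r \<in> T" "r = (\<one>\<^bsub>F\<^esub>, f) \<or> {r, (\<one>\<^bsub>F\<^esub>, f)} \<in> snd ?G"
      using global_offensive_alliance_dominates[OF T, of "(\<one>\<^bsub>F\<^esub>, f)"] unfolding V by auto
    \<comment> \<open>Neighbours of (0, 1) have second component zero. The only neighbour of (1, e)
      is (0, f), and the only neighbour of (1, f) is (0, e).\<close>
    have p': "snd p \<in> {\<zero>\<^bsub>R\<^esub>, \<one>\<^bsub>R\<^esub>}" using p(2) ec unfolding edge V by auto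
    have q': "q \<in> {(\<one>\<^bsub>F\<^esub>, e), (\<zero>\<^bsub>F\<^esub>, f)}"
      using q(2) ec e unfolding edge V by (auto simp: F.integral_iff)
    have r': "r \<in> {(\<one>\<^bsub>F\<^esub>, f), (\<zero>\<^bsub>F\<^esub>, e)}"
      using r(2) ec e unfolding edge V by (auto simp: F.integral_iff)
    have "p \<noteq> q" "p \<noteq> r" "q \<noteq> r" using p' q' r' ec ne1 e(4) by auto
    then have "card {p, q, r} = 3" by simp
    moreover have "card {p, q, r} \<le> card T"
      using p(1) q(1) r(1) TV finV by (intro card_mono) (auto intro: finite_subset)
    ultimately show "3 \<le> card T" by simp
  qed
qed

section \<open>The alliance number of the product\<close>

theorem theorem2p10:
  fixes R :: "('a, 'm) ring_scheme" and F :: "('b, 'n) ring_scheme"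
  assumes "cring R" and "\<one>\<^bsub>R\<^esub> \<noteq> \<zero>\<^bsub>R\<^esub>" and "finite (carrier R)"
    and "complete_sgraph (zero_divisor_graph R)"
    and "field F" and "finite (carrier F)" and "card (carrier F) \<ge> 3"
  shows "int (global_offensive_alliance_number (zero_divisor_graph (RDirProd F R))) =
    int (card (nonzero_zero_divisors R)) +
    Min {int (card (Units R)),
         int (card (carrier F - {\<zero>\<^bsub>F\<^esub>})),
         2 + \<lfloor>(real (card (Units R)) - real (card (nonzero_zero_divisors R))) / 2\<rfloor>
           + \<lfloor>real (card (carrier F - {\<zero>\<^bsub>F\<^esub>})) / 2\<rfloor>}"
proof -
  interpret F: field F by fact
  interpret R: cring R by fact
  let ?Z = "nonzero_zero_divisors R" and ?Fs = "carrier F - {\<zero>\<^bsub>F\<^esub>}"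
  have compl: "u \<otimes>\<^bsub>R\<^esub> v = \<zero>\<^bsub>R\<^esub>" if "u \<in> ?Z" "v \<in> ?Z" "u \<noteq> v" for u v
    using assms(4) that unfolding complete_sgraph_def
    by (simp add: R.edge_zero_divisor_graph_iff fst_zero_divisor_graph)
  have Fs: "card ?Fs \<ge> 2" using assms(6,7) by (simp add: card_Diff_singleton)
  \<comment> \<open>Integer \<open>div\<close> rounds down, so it agrees with the floor even when
    the difference is negative, as happens in the exceptional case.\<close>
  have floor: "\<lfloor>(real m - real n) / 2\<rfloor> = (int m - int n) div 2" for m n :: nat
    using floor_divide_of_int_eq[of "int m - int n" 2, where ?'a = real] by simp
  have floor': "\<lfloor>real m / 2\<rfloor> = int m div 2" for m :: nat
    using floor[of m 0] by simp
  show ?thesis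
  proof (cases "\<forall>x\<in>?Z. x \<otimes>\<^bsub>R\<^esub> x = \<zero>\<^bsub>R\<^esub>")
    case True
    then have Z: "x \<otimes>\<^bsub>R\<^esub> y = \<zero>\<^bsub>R\<^esub>" if "x \<in> ?Z" "y \<in> ?Z" for x y
      using that compl by (cases "x = y") auto
    interpret four_part_graph "zero_divisor_graph (RDirProd F R)"
      "?Fs \<times> {\<zero>\<^bsub>R\<^esub>}" "{\<zero>\<^bsub>F\<^esub>} \<times> Units R" "{\<zero>\<^bsub>F\<^esub>} \<times> ?Z" "?Fs \<times> ?Z"
      using four_part_graph_RDirProd[OF assms(5,1,2,3,6) Z] .
    have ZU: "card ?Z \<le> card (Units R)"
      using R.card_zero_divisors_le_card_Units[OF assms(3)] True by blast
    have "finite (Units R)" using assms(3) R.Units_closed finite_subset by blast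
    then have U: "0 < card (Units R)" using R.Units_one_closed by (auto simp: card_gt_0_iff)
    have num: "global_offensive_alliance_number (zero_divisor_graph (RDirProd F R)) =
      card ?Z + min (card (Units R)) (min (card ?Fs) (2 + (card (Units R) - card ?Z) div 2 + card ?Fs div 2))"
      using global_offensive_alliance_number_eq Fs ZU U
      by (simp add: card_cartesian_product card_cartesian_product_singleton del: card_Diff_insert)
    \<comment> \<open>By \<open>ZU\<close> the subtraction of natural numbers is not truncated, so
      it agrees with the integer one.\<close>
    have third: "2 + (int (card (Units R)) - int (card ?Z)) div 2 + int (card ?Fs) div 2 =
      int (2 + (card (Units R) - card ?Z) div 2 + card ?Fs div 2)"
      using ZU by (simp only: of_nat_add of_nat_diff zdiv_int of_nat_numeral)
    have Min3: "Min {int i, int j, int k} = int (min i (min j k))" for i j k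
      by (simp add: of_nat_min)
    show ?thesis unfolding floor floor' third num Min3 by (rule of_nat_add)
  next
    case False
    then obtain e where e: "e \<in> ?Z" "e \<otimes>\<^bsub>R\<^esub> e \<noteq> \<zero>\<^bsub>R\<^esub>" by auto
    have ee: "e \<otimes>\<^bsub>R\<^esub> e = e" using R.complete_zero_divisor_graph_idempotent[OF compl e] .
    obtain f where f: "f \<noteq> e" "e \<otimes>\<^bsub>R\<^esub> f = \<zero>\<^bsub>R\<^esub>" "f \<otimes>\<^bsub>R\<^esub> f = f" "?Z = {e, f}" "Units R = {\<one>\<^bsub>R\<^esub>}"
      using R.complete_zero_divisor_graph_not_square_zero[OF compl e] by blast
    have "global_offensive_alliance_number (zero_divisor_graph (RDirProd F R)) = 3"
      using global_offensive_alliance_number_RDirProd_idempotents[OF assms(5,1,2,3,6) ee f(3,2) _ f(4,5)] f(1)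
      by blast
    moreover have "card ?Z = 2" "card (Units R) = 1" using f by auto
    \<comment> \<open>Since (1 - 2) div 2 is -1 and \<open>card ?Fs\<close> is at least 2, the third
      entry is at least 2. The number of units attains the minimum, and the total is 2 + 1.\<close>
    moreover have "Min {1, int (card ?Fs), 2 + (1 - 2) div 2 + int (card ?Fs) div 2} = 1"
      using Fs by (auto simp: min_def)
    ultimately show ?thesis unfolding floor floor' by simp
  qed
qed

end
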